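(* Let $(G,+)$ be a finite abelian group, $n$ a positive integer, $W=G\wr S_n$ and $\underline\sigma\in\Sigma_n(G)$. Consider the stabiliser $H_{\underline\sigma}$ of a $\underline\sigma$-tabloid and write it as an internal direct product $H_{\underline\sigma}=H_1\times\dots\times H_\ell$ with $H_i=U_i\wr S_{A_i}$, where $U_i\le G$ are subgroups and $A_1,\dots,A_\ell$ are pairwise disjoint subsets of $[n]$ with $|A_i|=k_i$. Then $$C(\underline\sigma)=\Big\{\bigcup_{i=1}^\ell\underline\lambda^i:\ \underline\lambda^i\in\Lambda_{k_i}(U_i)\Big\}.$$
   Context: $[n]=\{1,\dots,n\}$. $W=G\wr S_n$ consists of pairs $(g,\pi)$, $g\in G^n$, $\pi\in S_n$, with $(f,\pi)(g,\sigma)=(f+g^\pi,\pi\sigma)$, $g^\pi=(g_{\pi^{-1}(1)},\dots,g_{\pi^{-1}(n)})$. For $U\le G$ and $A\subseteq[n]$, $U\wr S_A$ is the subgroup of pairs $(g,\pi)$ with $\pi$ fixing all points outside $A$, $g_a\in U$ for $a\in A$ and $g_i=0$ for $i\notin A$. $\mathrm{Par}$ is the set of partitions (weakly decreasing sequences of nonnegative integers with finite sum), $\emptyset$ the partition of $0$, $\lambda\cup\mu$ the partition with the parts of both. For a group $U$, $\Lambda_k(U)$ is the set of maps $\underline\lambda:U\to\mathrm{Par}$ with $\sum_{u}|\underline\lambda(u)|=k$; an element of $\Lambda_k(U)$ with $U\le G$ is regarded as a map on $G$ by setting $\underline\lambda(g)=\emptyset$ for $g\notin U$, and $(\bigcup_i\underline\lambda^i)(g)=\bigcup_i\underline\lambda^i(g)$.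 $\Sigma_n(G)$ is the set of maps $\underline\sigma$ from subgroups of $G$ to $\mathrm{Par}$ with $\sum_{U\le G}|\underline\sigma(U)|=n$. Tabloids: a $\underline\sigma$-tableau consists of, for each $U\le G$, the Young diagram of $\underline\sigma(U)$ with boxes filled by pairs $(c,i)$, $c\in G/U$, $i\in[n]$, all $i$ pairwise distinct; row-equivalence classes are $\underline\sigma$-tabloids; $W$ acts entrywise by $(g,\pi)\cdot(c,i)=(c+g_{\pi(i)},\pi(i))$. Conjugacy classes: for $(g,\pi)\in W$ and a cycle $(i_1\dots i_k)$ of $\pi$, its sign is $g_{i_1}+\dots+g_{i_k}$; the cycle type of $(g,\pi)$ is the map $\underline\lambda\in\Lambda_n(G)$ where $\underline\lambda(h)$ is the partition of the lengths of the cycles of $\pi$ with sign $h$ (fixed points count as cycles of length 1). Conjugacy classes of $W$ are $C_{\underline\lambda}$, the set of elements of cycle type $\underline\lambda$. $C(\underline\sigma)$ is the set of $\underline\lambda\in\Lambda_n(G)$ such that $C_{\underline\lambda}\cap H_{\underline\sigma}\neq\emptyset$.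
   Formalization: The sets A_1,…,A_ℓ are additionally required to cover [n]; without this the claim fails (e.g. G trivial, n=1, ℓ=1, A_1 empty), since the unions on the right would have total size less than n. *)

theory Defs
  imports
    "HOL-Combinatorics.Orbits"
    "HOL-Library.Multiset"
    "HOL-Library.Disjoint_Sets"
    "HOL-Algebra.Group_Action"
    "HOL-Algebra.Product_Groups"
    "HOL-Algebra.FiniteProduct"
begin

text \<open>
  The finite abelian group is a HOL-Algebra structure and hence written multiplicatively: the
  sum in the paper is the group multiplication, and the zero element is the unit.
  The index set \<open>[n]\<close> is \<open>{1..n}\<close>.
\<close>

subsection \<open>Wreath products\<close>

text \<open>Elements of \<open>G\<^sup>n\<close> are the extensional functions from \<open>{1..n}\<close> to the carrier.\<close>

definition wreath :: "('a, 'b) monoid_scheme \<Rightarrow> nat \<Rightarrow> ((nat \<Rightarrow> 'a) \<times> (nat \<Rightarrow> nat)) monoid" where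
  "wreath G n =
    \<lparr>carrier = ({1..n} \<rightarrow>\<^sub>E carrier G) \<times> {\<pi>. \<pi> permutes {1..n}},
     monoid.mult = (\<lambda>(f, \<pi>) (g, \<sigma>).
       ((\<lambda>i\<in>{1..n}. f i \<otimes>\<^bsub>G\<^esub> g (inv_into UNIV \<pi> i)), \<pi> \<circ> \<sigma>)),
     one = ((\<lambda>i\<in>{1..n}. \<one>\<^bsub>G\<^esub>), id)\<rparr>"

text \<open>The subgroup \<open>U \<wr> S\<^sub>A\<close>, for \<open>A \<subseteq> {1..n}\<close>.\<close>

definition wreath_sub ::
  "('a, 'b) monoid_scheme \<Rightarrow> nat \<Rightarrow> 'a set \<Rightarrow> nat set \<Rightarrow> ((nat \<Rightarrow> 'a) \<times> (nat \<Rightarrow> nat)) set" where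
  "wreath_sub G n U A =
    {(g, \<pi>) \<in> carrier (wreath G n).
       (\<forall>i. i \<notin> A \<longrightarrow> \<pi> i = i) \<and> (\<forall>a\<in>A. g a \<in> U) \<and> (\<forall>i\<in>{1..n} - A. g i = \<one>\<^bsub>G\<^esub>)}"

text \<open>
  \<open>H\<close> is the internal direct product of \<open>Hs 1, \<dots>, Hs l\<close>: these are subgroups, and
  \<open>(h\<^sub>1, \<dots>, h\<^sub>l) \<mapsto> h\<^sub>1 \<dots> h\<^sub>l\<close> is an isomorphism from the external direct product onto \<open>H\<close>.
\<close>

definition internal_direct_product ::
  "('a, 'b) monoid_scheme \<Rightarrow> 'a set \<Rightarrow> nat \<Rightarrow> (nat \<Rightarrow> 'a set) \<Rightarrow> bool" where
  "internal_direct_product W H l Hs \<longleftrightarrow>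
     subgroup H W \<and> (\<forall>i\<in>{1..l}. subgroup (Hs i) W) \<and>
     (\<lambda>h. foldr (\<otimes>\<^bsub>W\<^esub>) (map h [1..<Suc l]) \<one>\<^bsub>W\<^esub>)
       \<in> iso (product_group {1..l} (\<lambda>i. W\<lparr>carrier := Hs i\<rparr>)) (W\<lparr>carrier := H\<rparr>)"

subsection \<open>Partitions and partition-valued maps\<close>

text \<open>
  A partition is the weakly decreasing list of its positive parts (the trailing zeros of the
  infinite sequence are dropped), so the partition of 0 is \<open>[]\<close> and the size is \<^const>\<open>sum_list\<close>.
\<close>

definition Par :: "nat list set" where
  "Par = {p. sorted_wrt (\<ge>) p \<and> 0 \<notin> set p}"

definition partition_of :: "nat multiset \<Rightarrow> nat list" where
  "partition_of M = rev (sorted_list_of_multiset M)"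

definition par_union :: "nat list \<Rightarrow> nat list \<Rightarrow> nat list" where
  "par_union p q = partition_of (mset p + mset q)"

definition map_union :: "nat \<Rightarrow> (nat \<Rightarrow> 'a \<Rightarrow> nat list) \<Rightarrow> 'a \<Rightarrow> nat list" where
  "map_union l ls = (\<lambda>g. foldr par_union (map (\<lambda>i. ls i g) [1..<Suc l]) [])"

text \<open>
  \<open>\<Lambda>\<^sub>k(U)\<close>. Requiring the value \<open>[]\<close> outside \<open>U\<close> builds in the extension of such a map by the
  empty partition to the whole group.
\<close>

definition Lam :: "nat \<Rightarrow> 'a set \<Rightarrow> ('a \<Rightarrow> nat list) set" where
  "Lam k U = {la. (\<forall>u\<in>U. la u \<in> Par) \<and> (\<forall>g. g \<notin> U \<longrightarrow> la g = []) \<and>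
                  (\<Sum>u\<in>U. sum_list (la u)) = k}"

text \<open>\<open>\<Sigma>\<^sub>n(G)\<close>; arguments that are not subgroups get the dummy value \<open>[]\<close>.\<close>

definition Sig :: "('a, 'b) monoid_scheme \<Rightarrow> nat \<Rightarrow> ('a set \<Rightarrow> nat list) set" where
  "Sig G n = {\<sigma>. (\<forall>U. subgroup U G \<longrightarrow> \<sigma> U \<in> Par) \<and> (\<forall>U. \<not> subgroup U G \<longrightarrow> \<sigma> U = []) \<and>
                 (\<Sum>U\<in>{U. subgroup U G}. sum_list (\<sigma> U)) = n}"

subsection \<open>Tabloids\<close>

text \<open>Box \<open>(U, r, c)\<close> is in row \<open>r\<close>, column \<open>c\<close> (both from 0) of the Young diagram of \<open>\<sigma> U\<close>.\<close>

definition boxes :: "('a, 'b) monoid_scheme \<Rightarrow> ('a set \<Rightarrow> nat list) \<Rightarrow> ('a set \<times> nat \<times> nat) set" where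
  "boxes G \<sigma> = {(U, r, c). subgroup U G \<and> r < length (\<sigma> U) \<and> c < \<sigma> U ! r}"

definition tableaux ::
  "('a, 'b) monoid_scheme \<Rightarrow> nat \<Rightarrow> ('a set \<Rightarrow> nat list)
     \<Rightarrow> ('a set \<times> nat \<times> nat \<Rightarrow> 'a set \<times> nat) set" where
  "tableaux G n \<sigma> =
    {T \<in> extensional (boxes G \<sigma>).
       (\<forall>(U, r, c)\<in>boxes G \<sigma>. T (U, r, c) \<in> (rcosets\<^bsub>G\<^esub> U) \<times> {1..n}) \<and>
       inj_on (snd \<circ> T) (boxes G \<sigma>)}"

text \<open>Tableaux are row-equivalent if corresponding rows contain the same entries.\<close>

definition row_entries ::
  "('a, 'b) monoid_scheme \<Rightarrow> ('a set \<Rightarrow> nat list) \<Rightarrow> ('a set \<times> nat \<times> nat \<Rightarrow> 'a set \<times> nat)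
     \<Rightarrow> 'a set \<Rightarrow> nat \<Rightarrow> ('a set \<times> nat) set" where
  "row_entries G \<sigma> T U r = {T (U, r, c) | c. (U, r, c) \<in> boxes G \<sigma>}"

definition row_equiv ::
  "('a, 'b) monoid_scheme \<Rightarrow> nat \<Rightarrow> ('a set \<Rightarrow> nat list)
     \<Rightarrow> ('a set \<times> nat \<times> nat \<Rightarrow> 'a set \<times> nat) rel" where
  "row_equiv G n \<sigma> =
    {(S, T). S \<in> tableaux G n \<sigma> \<and> T \<in> tableaux G n \<sigma> \<and>
             (\<forall>U r. row_entries G \<sigma> S U r = row_entries G \<sigma> T U r)}"

definition tabloids ::
  "('a, 'b) monoid_scheme \<Rightarrow> nat \<Rightarrow> ('a set \<Rightarrow> nat list)
     \<Rightarrow> ('a set \<times> nat \<times> nat \<Rightarrow> 'a set \<times> nat) set set" where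
  "tabloids G n \<sigma> = tableaux G n \<sigma> // row_equiv G n \<sigma>"

definition entry_act ::
  "('a, 'b) monoid_scheme \<Rightarrow> (nat \<Rightarrow> 'a) \<times> (nat \<Rightarrow> nat) \<Rightarrow> 'a set \<times> nat \<Rightarrow> 'a set \<times> nat" where
  "entry_act G = (\<lambda>(g, \<pi>) (c, i). (c #>\<^bsub>G\<^esub> g (\<pi> i), \<pi> i))"

definition tabloid_act ::
  "('a, 'b) monoid_scheme \<Rightarrow> ('a set \<Rightarrow> nat list) \<Rightarrow> (nat \<Rightarrow> 'a) \<times> (nat \<Rightarrow> nat)
     \<Rightarrow> ('a set \<times> nat \<times> nat \<Rightarrow> 'a set \<times> nat) set \<Rightarrow> ('a set \<times> nat \<times> nat \<Rightarrow> 'a set \<times> nat) set" where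
  "tabloid_act G \<sigma> w t = (\<lambda>T. \<lambda>b\<in>boxes G \<sigma>. entry_act G w (T b)) ` t"

definition tabloid_stab ::
  "('a, 'b) monoid_scheme \<Rightarrow> nat \<Rightarrow> ('a set \<Rightarrow> nat list)
     \<Rightarrow> ('a set \<times> nat \<times> nat \<Rightarrow> 'a set \<times> nat) set \<Rightarrow> ((nat \<Rightarrow> 'a) \<times> (nat \<Rightarrow> nat)) set" where
  "tabloid_stab G n \<sigma> t = stabilizer (wreath G n) (tabloid_act G \<sigma>) t"

subsection \<open>Cycle types\<close>

text \<open>
  A cycle of \<open>\<pi>\<close> is represented by its set of points, an orbit of \<open>\<pi>\<close>; for a permutation of a
  finite set this contains the point itself, so a fixed point gives a singleton. Since the group
  is abelian, the sign of a cycle depends only on this set.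
\<close>

definition cycles_on :: "nat \<Rightarrow> (nat \<Rightarrow> nat) \<Rightarrow> nat set set" where
  "cycles_on n \<pi> = (\<lambda>i. Orbits.orbit \<pi> i) ` {1..n}"

definition cycle_sign :: "('a, 'b) monoid_scheme \<Rightarrow> (nat \<Rightarrow> 'a) \<Rightarrow> nat set \<Rightarrow> 'a" where
  "cycle_sign G g c = (\<Otimes>\<^bsub>G\<^esub>i\<in>c. g i)"

definition cycle_type ::
  "('a, 'b) monoid_scheme \<Rightarrow> nat \<Rightarrow> (nat \<Rightarrow> 'a) \<times> (nat \<Rightarrow> nat) \<Rightarrow> 'a \<Rightarrow> nat list" where
  "cycle_type G n = (\<lambda>(g, \<pi>) h.
     partition_of (image_mset card (mset_set {c \<in> cycles_on n \<pi>. cycle_sign G g c = h})))"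

definition conj_class ::
  "('a, 'b) monoid_scheme \<Rightarrow> nat \<Rightarrow> ('a \<Rightarrow> nat list) \<Rightarrow> ((nat \<Rightarrow> 'a) \<times> (nat \<Rightarrow> nat)) set" where
  "conj_class G n la = {w \<in> carrier (wreath G n). cycle_type G n w = la}"

text \<open>
  \<open>C(\<sigma>)\<close>, formed with the stabiliser of the tabloid \<open>t\<close>. Stabilisers of different
  \<open>\<sigma>\<close>-tabloids are conjugate, so the set does not depend on \<open>t\<close>.
\<close>

definition C_set ::
  "('a, 'b) monoid_scheme \<Rightarrow> nat \<Rightarrow> ('a set \<Rightarrow> nat list)
     \<Rightarrow> ('a set \<times> nat \<times> nat \<Rightarrow> 'a set \<times> nat) set \<Rightarrow> ('a \<Rightarrow> nat list) set" where
  "C_set G n \<sigma> t =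
     {la \<in> Lam n (carrier G). conj_class G n la \<inter> tabloid_stab G n \<sigma> t \<noteq> {}}"

end

theory Submission
  imports Defs
begin

text \<open>
  Multiplying out the internal direct product shows that the stabiliser consists of the
  \<open>(g, \<pi>)\<close> such that \<open>\<pi>\<close> preserves every \<open>A\<^sub>i\<close> and \<open>g\<close> maps \<open>A\<^sub>i\<close> into \<open>U\<^sub>i\<close>. Hence every cycle
  of \<open>\<pi>\<close> lies in some \<open>A\<^sub>i\<close>, and its sign lies in \<open>U\<^sub>i\<close>; sorting the cycles by \<open>i\<close> splits the
  cycle type into a union. Conversely, a family of \<open>\<lambda>\<^sup>i\<close> prescribes a set partition of each
  \<open>A\<^sub>i\<close> with a label in \<open>U\<^sub>i\<close> on each block; make every block a cycle and put its label at one
  point of it, with the unit elsewhere.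
\<close>

section \<open>Products of elements of the subgroups \<open>wreath_sub\<close>\<close>

lemma permutes_of_wreath_sub: "h \<in> wreath_sub G n U A \<Longrightarrow> snd h permutes A"
  by (auto simp: wreath_sub_def wreath_def intro: permutes_superset)

text \<open>The factors have disjoint supports, so at a point of \<open>A i\<close> only the factor
  \<open>h i\<close> acts, and only if it occurs in the list. Allowing any distinct list
  \<open>xs\<close> of indices, rather than the full one, makes induction on the list
  possible.\<close>

lemma foldr_wreath_mult:
  assumes G: "comm_group G"
    and dis: "disjoint_family_on A I"
    and cov: "(\<Union>i\<in>I. A i) = {1..n}"
    and h: "\<And>i. i \<in> I \<Longrightarrow> h i \<in> wreath_sub G n (U i) (A i)"
    and xs: "distinct xs" "set xs \<subseteq> I"
  shows "foldr (\<otimes>\<^bsub>wreath G n\<^esub>) (map h xs) \<one>\<^bsub>wreath G n\<^esub> \<in> carrier (wreath G n)"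
    and "\<And>i a. i \<in> I \<Longrightarrow> a \<in> A i \<Longrightarrow>
      fst (foldr (\<otimes>\<^bsub>wreath G n\<^esub>) (map h xs) \<one>\<^bsub>wreath G n\<^esub>) a
        = (if i \<in> set xs then fst (h i) a else \<one>\<^bsub>G\<^esub>)"
    and "\<And>i a. i \<in> I \<Longrightarrow> a \<in> A i \<Longrightarrow>
      snd (foldr (\<otimes>\<^bsub>wreath G n\<^esub>) (map h xs) \<one>\<^bsub>wreath G n\<^esub>) a
        = (if i \<in> set xs then snd (h i) a else a)"
proof -
  interpret comm_group G by fact
  let ?W = "wreath G n"
  let ?p = "\<lambda>xs. foldr (\<otimes>\<^bsub>?W\<^esub>) (map h xs) \<one>\<^bsub>?W\<^esub>"
  have "?p xs \<in> carrier ?W \<and> (\<forall>i\<in>I. \<forall>a\<in>A i.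
      fst (?p xs) a = (if i \<in> set xs then fst (h i) a else \<one>\<^bsub>G\<^esub>) \<and>
      snd (?p xs) a = (if i \<in> set xs then snd (h i) a else a))"
    using xs
  proof (induction xs)
    case Nil
    then show ?case using cov
      by (auto simp: wreath_def permutes_id)
  next
    case (Cons j xs)
    obtain f \<tau> where hj: "h j = (f, \<tau>)" by fastforce
    obtain g \<pi> where p: "?p xs = (g, \<pi>)" by fastforce
    have j: "j \<in> I" "j \<notin> set xs" using Cons.prems by auto
    have f: "f \<in> {1..n} \<rightarrow>\<^sub>E carrier G" and \<tau>: "\<tau> permutes {1..n}"
      and \<tau>_out: "\<And>i. i \<notin> A j \<Longrightarrow> \<tau> i = i"
      and f_out: "\<And>i. i \<in> {1..n} \<Longrightarrow> i \<notin> A j \<Longrightarrow> f i = \<one>\<^bsub>G\<^esub>"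
      using h[OF j(1)] unfolding hj wreath_sub_def by (auto simp: wreath_def)
    from Cons have IH: "(g, \<pi>) \<in> carrier ?W"
      "\<And>i a. i \<in> I \<Longrightarrow> a \<in> A i \<Longrightarrow> g a = (if i \<in> set xs then fst (h i) a else \<one>\<^bsub>G\<^esub>)"
      "\<And>i a. i \<in> I \<Longrightarrow> a \<in> A i \<Longrightarrow> \<pi> a = (if i \<in> set xs then snd (h i) a else a)"
      unfolding p by auto
    have g: "g \<in> {1..n} \<rightarrow>\<^sub>E carrier G" and \<pi>: "\<pi> permutes {1..n}"
      using IH(1) by (auto simp: wreath_def)
    have pj: "?p (j # xs) = ((\<lambda>i\<in>{1..n}. f i \<otimes>\<^bsub>G\<^esub> g (inv_into UNIV \<tau> i)), \<tau> \<circ> \<pi>)"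
      by (simp add: p hj) (simp add: wreath_def)
    have \<tau>inv: "inv_into UNIV \<tau> permutes {1..n}" using \<tau> by (rule permutes_inv)
    have \<tau>A: "\<tau> permutes A j"
      using permutes_of_wreath_sub[OF h[OF j(1)]] by (simp add: hj)
    have val: "fst (?p (j # xs)) a = (if i \<in> set (j # xs) then fst (h i) a else \<one>\<^bsub>G\<^esub>) \<and>
      snd (?p (j # xs)) a = (if i \<in> set (j # xs) then snd (h i) a else a)"
      if i: "i \<in> I" and a: "a \<in> A i" for i a
    proof (cases "i = j")
      case True
      have an: "a \<in> {1..n}" using cov i a by auto
      \<comment> \<open>Multiplication twists \<open>g\<close> by the inverse of
        \<open>\<tau>\<close>. The twisted argument stays in \<open>A j\<close>, where the product
        over \<open>xs\<close> is still trivial because \<open>j\<close> is not in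
        \<open>xs\<close>.\<close>
      have "inv_into UNIV \<tau> a \<in> A j" using permutes_in_image[OF permutes_inv[OF \<tau>A]] a True by auto
      hence "g (inv_into UNIV \<tau> a) = \<one>\<^bsub>G\<^esub>" using IH(2)[OF j(1)] j by simp
      moreover have "\<pi> a = a" using IH(3)[OF j(1)] a j True by simp
      moreover have "f a \<in> carrier G" using f an by auto
      ultimately show ?thesis using True an unfolding pj by (simp add: hj)
    next
      case False
      have an: "a \<in> {1..n}" using cov i a by auto
      have disj: "A i \<inter> A j = {}" using dis i j False by (auto simp: disjoint_family_on_def)
      hence na: "a \<notin> A j" using a by auto
      have "\<tau> a = a" by (rule \<tau>_out[OF na])
      hence inva: "inv_into UNIV \<tau> a = a" using \<tau> by (metis permutes_inverses(2))
      \<comment> \<open>The tail of the product moves \<open>a\<close> only within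
        \<open>A i\<close>, so the new factor \<open>\<tau>\<close> fixes the image.\<close>
      have "\<pi> a \<notin> A j"
      proof (cases "i \<in> set xs")
        case True
        have "snd (h i) permutes A i" by (rule permutes_of_wreath_sub[OF h[OF i]])
        hence "snd (h i) a \<in> A i" using a by (simp add: permutes_in_image)
        thus ?thesis using IH(3)[OF i a] disj True by auto
      next
        case False
        thus ?thesis using IH(3)[OF i a] na by auto
      qed
      hence "\<tau> (\<pi> a) = \<pi> a" by (rule \<tau>_out)
      moreover have "g a \<in> carrier G" using g an by auto
      ultimately show ?thesis
        using False an inva f_out[OF an na] IH(2)[OF i a] IH(3)[OF i a] unfolding pj by simp
    qed
    have "?p (j # xs) \<in> carrier ?W"
      unfolding pj using f g permutes_in_image[OF \<tau>inv] permutes_compose[OF \<pi> \<tau>]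
      by (auto simp: wreath_def PiE_iff)
    with val show ?case by blast
  qed
  thus "?p xs \<in> carrier ?W"
    "\<And>i a. i \<in> I \<Longrightarrow> a \<in> A i \<Longrightarrow> fst (?p xs) a = (if i \<in> set xs then fst (h i) a else \<one>\<^bsub>G\<^esub>)"
    "\<And>i a. i \<in> I \<Longrightarrow> a \<in> A i \<Longrightarrow> snd (?p xs) a = (if i \<in> set xs then snd (h i) a else a)"
    by blast+
qed

text \<open>The isomorphism exhibits \<open>H\<close> as the image of the multiplication map on
  families \<open>h\<close>. Since products are computed pointwise on each \<open>A i\<close>,
  membership in this image becomes a separate condition on each \<open>A i\<close>.\<close>

lemma internal_direct_product_wreath_sub:
  assumes G: "comm_group G"
    and dis: "disjoint_family_on A {1..l}"
    and cov: "(\<Union>i\<in>{1..l}. A i) = {1..n}"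
    and idp: "internal_direct_product (wreath G n) H l (\<lambda>i. wreath_sub G n (U i) (A i))"
  shows "H = {(g, \<pi>) \<in> carrier (wreath G n). \<forall>i\<in>{1..l}. \<forall>a\<in>A i. \<pi> a \<in> A i \<and> g a \<in> U i}"
    (is "_ = ?R")
proof -
  let ?W = "wreath G n"
  let ?p = "\<lambda>h. foldr (\<otimes>\<^bsub>?W\<^esub>) (map h [1..<Suc l]) \<one>\<^bsub>?W\<^esub>"
  let ?D = "\<Pi>\<^sub>E i\<in>{1..l}. wreath_sub G n (U i) (A i)"
  have H: "H = ?p ` ?D"
    using idp unfolding internal_direct_product_def iso_def bij_betw_def by auto
  have xs: "distinct [1..<Suc l]" "set [1..<Suc l] \<subseteq> {1..l}" by auto
  have in_set: "i \<in> set [1..<Suc l] \<longleftrightarrow> i \<in> {1..l}" for i by auto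
  note prod = foldr_wreath_mult[OF G dis cov _ xs, unfolded in_set]
  have val: "?p h \<in> carrier ?W"
    "\<And>i a. i \<in> {1..l} \<Longrightarrow> a \<in> A i \<Longrightarrow> fst (?p h) a = fst (h i) a"
    "\<And>i a. i \<in> {1..l} \<Longrightarrow> a \<in> A i \<Longrightarrow> snd (?p h) a = snd (h i) a" if "h \<in> ?D" for h
    using prod[where h = h and U = U] that by (auto simp: PiE_iff simp del: upt_Suc)
  have "?p h \<in> ?R" if h: "h \<in> ?D" for h
  proof -
    have "snd (h i) a \<in> A i \<and> fst (h i) a \<in> U i" if "i \<in> {1..l}" "a \<in> A i" for i a
    proof -
      have hi: "h i \<in> wreath_sub G n (U i) (A i)" using h that by auto
      hence "snd (h i) permutes A i" by (rule permutes_of_wreath_sub)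
      thus ?thesis using hi that by (auto simp: wreath_sub_def permutes_in_image)
    qed
    thus ?thesis using val[OF h] by (auto simp: case_prod_beta simp del: upt_Suc)
  qed
  moreover have "w \<in> ?p ` ?D" if w: "w \<in> ?R" for w
  proof -
    obtain g \<pi> where w_eq: "w = (g, \<pi>)" by fastforce
    have g: "g \<in> {1..n} \<rightarrow>\<^sub>E carrier G" and \<pi>: "\<pi> permutes {1..n}"
      and pres: "\<And>i a. i \<in> {1..l} \<Longrightarrow> a \<in> A i \<Longrightarrow> \<pi> a \<in> A i \<and> g a \<in> U i"
      using w by (auto simp: w_eq wreath_def)
    \<comment> \<open>The components of \<open>w\<close>: cut \<open>g\<close> and
      \<open>\<pi>\<close> down to \<open>A i\<close>, filling up with the unit and the
      identity.\<close>
    define h where "h = (\<lambda>i\<in>{1..l}.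
      ((\<lambda>x\<in>{1..n}. if x \<in> A i then g x else \<one>\<^bsub>G\<^esub>), (\<lambda>x. if x \<in> A i then \<pi> x else x)))"
    have hD: "h \<in> ?D"
    proof (intro PiE_I)
      fix i assume i: "i \<in> {1..l}"
      have An: "A i \<subseteq> {1..n}" using i cov by auto
      hence fin: "finite (A i)" by (rule finite_subset) simp
      \<comment> \<open>An injective map of the finite set \<open>A i\<close> into itself is onto,
        so the truncation of \<open>\<pi>\<close> is again a permutation.\<close>
      have "inj_on \<pi> (A i)" using \<pi> by (auto intro: permutes_inj_on)
      moreover have "\<pi> ` A i \<subseteq> A i" using pres[OF i] by auto
      ultimately have "bij_betw \<pi> (A i) (A i)" using fin by (simp add: bij_betw_def endo_inj_surj)
      hence "bij_betw (\<lambda>x. if x \<in> A i then \<pi> x else x) (A i) (A i)"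
        by (simp cong: bij_betw_cong)
      hence "(\<lambda>x. if x \<in> A i then \<pi> x else x) permutes A i"
        by (intro bij_imp_permutes) auto
      hence "(\<lambda>x. if x \<in> A i then \<pi> x else x) permutes {1..n}"
        using An by (rule permutes_subset)
      moreover have "\<one>\<^bsub>G\<^esub> \<in> carrier G" using G by (simp add: comm_group_def group.is_monoid)
      ultimately show "h i \<in> wreath_sub G n (U i) (A i)"
        using i An g pres[OF i] by (auto simp: h_def wreath_sub_def wreath_def PiE_iff)
    qed (auto simp: h_def)
    have "?p h = w"
    proof (rule prod_eqI)
      have pc: "fst (?p h) \<in> {1..n} \<rightarrow>\<^sub>E carrier G" "snd (?p h) permutes {1..n}"
        using val(1)[OF hD] by (auto simp: wreath_def mem_Times_iff simp del: upt_Suc)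
      have eq: "fst (?p h) a = g a \<and> snd (?p h) a = \<pi> a" if "a \<in> {1..n}" for a
      proof -
        from that cov obtain i where i: "i \<in> {1..l}" "a \<in> A i" by blast
        have "h i = ((\<lambda>x\<in>{1..n}. if x \<in> A i then g x else \<one>\<^bsub>G\<^esub>), (\<lambda>x. if x \<in> A i then \<pi> x else x))"
          using i by (simp add: h_def)
        with val(2,3)[OF hD i] i that show ?thesis by (simp del: upt_Suc)
      qed
      show "fst (?p h) = fst w"
        using PiE_ext[OF pc(1) g] eq by (simp add: w_eq del: upt_Suc)
      show "snd (?p h) = snd w"
      proof
        fix x show "snd (?p h) x = snd w x"
          using eq[of x] pc(2) \<pi> by (cases "x \<in> {1..n}") (simp_all add: w_eq permutes_not_in del: upt_Suc)
      qed
    qed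
    from this[symmetric] hD show ?thesis by (rule image_eqI)
  qed
  ultimately show ?thesis unfolding H by (intro subset_antisym image_subsetI subsetI)
qed

section \<open>Partitions as multisets of parts, and their unions\<close>

lemma mset_partition_of [simp]: "mset (partition_of M) = M"
  by (simp add: partition_of_def)

lemma partition_of_in_Par: "0 \<notin># M \<Longrightarrow> partition_of M \<in> Par"
  unfolding Par_def partition_of_def by (simp add: sorted_wrt_rev)

lemma partition_of_mset: "p \<in> Par \<Longrightarrow> partition_of (mset p) = p"
proof -
  assume "p \<in> Par"
  hence "sorted (rev p)" by (simp add: Par_def sorted_wrt_rev)
  hence "sort p = rev p"
    by (metis mset_rev properties_for_sort)
  thus ?thesis by (simp add: partition_of_def)
qed

lemma sum_list_partition_of [simp]: "sum_list (partition_of M) = \<Sum>\<^sub># M"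
  by (metis mset_partition_of sum_mset_sum_list)

text \<open>Each \<open>par_union\<close> sorts its result, but the next one looks only at the
  multiset of parts; hence a single sorting at the end suffices.\<close>

lemma map_union_eq:
  "map_union l ls g = partition_of (\<Sum>i\<in>{1..l}. mset (ls i g))"
proof -
  have "foldr par_union (map (\<lambda>i. ls i g) xs) [] = partition_of (\<Sum>i\<leftarrow>xs. mset (ls i g))" for xs
    by (induction xs) (simp_all add: par_union_def, simp add: partition_of_def)
  from this[of "[1..<Suc l]"] show ?thesis unfolding map_union_def
    by (simp add: interv_sum_list_conv_sum_set_nat atLeastLessThanSuc_atLeastAtMost del: upt_Suc)
qed

text \<open>Sizes add under unions, so exchanging the two sums leaves the sizes of the single
  \<open>la i\<close>. Enlarging \<open>U i\<close> to \<open>C\<close> adds only empty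
  partitions.\<close>

lemma map_union_in_Lam:
  assumes "finite C" and U: "\<And>i. i \<in> {1..l} \<Longrightarrow> U i \<subseteq> C"
    and la: "\<And>i. i \<in> {1..l} \<Longrightarrow> la i \<in> Lam (k i) (U i)"
  shows "map_union l la \<in> Lam (\<Sum>i\<in>{1..l}. k i) C"
proof -
  have out: "la i g = []" if "i \<in> {1..l}" "g \<notin> U i" for i g
    using la that by (auto simp: Lam_def)
  have pos: "0 \<notin> set (la i g)" if "i \<in> {1..l}" for i g
    using la[OF that] out[OF that, of g] by (cases "g \<in> U i") (auto simp: Lam_def Par_def)
  have "\<Sum>\<^sub># (\<Sum>i\<in>J. M i) = (\<Sum>i\<in>J. \<Sum>\<^sub># (M i))" for J :: "nat set" and M :: "nat \<Rightarrow> nat multiset"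
    by (induction J rule: infinite_finite_induct) auto
  hence "(\<Sum>u\<in>C. sum_list (map_union l la u)) = (\<Sum>i\<in>{1..l}. \<Sum>u\<in>C. sum_list (la i u))"
    unfolding map_union_eq by (subst sum.swap) (simp add: sum_mset_sum_list)
  also have "\<dots> = (\<Sum>i\<in>{1..l}. \<Sum>u\<in>U i. sum_list (la i u))"
    using out U \<open>finite C\<close> by (intro sum.cong refl sum.mono_neutral_right) auto
  also have "\<dots> = (\<Sum>i\<in>{1..l}. k i)"
    using la by (intro sum.cong) (auto simp: Lam_def)
  finally have "(\<Sum>u\<in>C. sum_list (map_union l la u)) = (\<Sum>i\<in>{1..l}. k i)" .
  moreover have "map_union l la g \<in> Par" for g
    unfolding map_union_eq using pos by (intro partition_of_in_Par) (auto simp: set_mset_sum)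
  moreover have "map_union l la g = []" if "g \<notin> C" for g
  proof -
    have "(\<Sum>i\<in>{1..l}. mset (la i g)) = {#}" using U out that by (intro sum.neutral ballI)
        (metis mset.simps(1) subsetD)
    thus ?thesis by (simp add: map_union_eq partition_of_def)
  qed
  ultimately show ?thesis by (auto simp: Lam_def)
qed

section \<open>Types of labelled set partitions\<close>

text \<open>The cycle type with the cycles and their signs replaced by the blocks of an arbitrary set
  partition and arbitrary labels.\<close>

definition block_type :: "'c set set \<Rightarrow> ('c set \<Rightarrow> 'a) \<Rightarrow> 'a \<Rightarrow> nat list" where
  "block_type P s h = partition_of (image_mset card (mset_set {c \<in> P. s c = h}))"

lemma cycle_type_eq_block_type:
  "cycle_type G n (g, \<pi>) = block_type (cycles_on n \<pi>) (cycle_sign G g)"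
  by (auto simp: cycle_type_def block_type_def)

text \<open>Blocks are nonempty and the sets \<open>A i\<close> disjoint, so no block lies in two of
  the \<open>P i\<close>. The multisets of blocks with label \<open>h\<close> therefore add
  up.\<close>

lemma block_type_Union:
  assumes P: "\<And>i. i \<in> {1..l} \<Longrightarrow> partition_on (A i) (P i)"
    and fin: "\<And>i. i \<in> {1..l} \<Longrightarrow> finite (A i)"
    and dis: "disjoint_family_on A {1..l}"
  shows "block_type (\<Union>i\<in>{1..l}. P i) s = map_union l (\<lambda>i. block_type (P i) s)"
proof
  fix h
  have disP: "P i \<inter> P j = {}" if "i \<in> {1..l}" "j \<in> {1..l}" "i \<noteq> j" for i j
  proof -
    have "A i \<inter> A j = {}" using dis that by (auto simp: disjoint_family_on_def)
    moreover have "c \<subseteq> A i" "c \<subseteq> A j" "c \<noteq> {}" if "c \<in> P i" "c \<in> P j" for c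
      using P[OF \<open>i \<in> {1..l}\<close>] P[OF \<open>j \<in> {1..l}\<close>] that by (auto simp: partition_on_def)
    ultimately show ?thesis by (metis Int_emptyI le_inf_iff subset_empty)
  qed
  have finP: "finite (P i)" if "i \<in> {1..l}" for i
    using finite_elements[OF fin[OF that] P[OF that]] .
  have "mset_set {c \<in> (\<Union>i\<in>J. P i). s c = h} = (\<Sum>i\<in>J. mset_set {c \<in> P i. s c = h})"
    if "finite J" "J \<subseteq> {1..l}" for J
    using that
  proof (induction J)
    case (insert j J)
    have eq: "{c \<in> (\<Union>i\<in>insert j J. P i). s c = h}
        = {c \<in> P j. s c = h} \<union> {c \<in> (\<Union>i\<in>J. P i). s c = h}"
      by auto
    have "mset_set ({c \<in> P j. s c = h} \<union> {c \<in> (\<Union>i\<in>J. P i). s c = h})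
        = mset_set {c \<in> P j. s c = h} + mset_set {c \<in> (\<Union>i\<in>J. P i). s c = h}"
    proof (rule mset_set_Union)
      show "finite {c \<in> P j. s c = h}" using finP insert.prems by auto
      show "finite {c \<in> (\<Union>i\<in>J. P i). s c = h}"
        by (rule finite_subset[of _ "\<Union>i\<in>J. P i"]) (use finP insert in auto)
      show "{c \<in> P j. s c = h} \<inter> {c \<in> (\<Union>i\<in>J. P i). s c = h} = {}"
        using disP insert.prems insert.hyps by blast
    qed
    thus ?case unfolding eq using insert by simp
  qed auto
  from this[of "{1..l}"]
  have eq: "mset_set {c \<in> (\<Union>i\<in>{1..l}. P i). s c = h} = (\<Sum>i\<in>{1..l}. mset_set {c \<in> P i. s c = h})"
    by simp
  have im: "image_mset card (\<Sum>i\<in>J. M i) = (\<Sum>i\<in>J. image_mset card (M i))"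
    if "finite J" for J :: "nat set" and M :: "nat \<Rightarrow> 'a set multiset"
    using that by (induction J) auto
  show "block_type (\<Union>i\<in>{1..l}. P i) s h = map_union l (\<lambda>i. block_type (P i) s) h"
    unfolding map_union_eq block_type_def mset_partition_of eq by (subst im) auto
qed

text \<open>Grouping the blocks by label turns the total size into the sum of all block sizes, which
  is \<open>card A\<close>. Nonempty finite blocks exclude parts equal to 0.\<close>

lemma block_type_in_Lam:
  assumes P: "partition_on A P" and "finite A" "finite U" and s: "s ` P \<subseteq> U"
  shows "block_type P s \<in> Lam (card A) U"
proof -
  have finP: "finite P" by (rule finite_elements[OF \<open>finite A\<close> P])
  have finc: "finite c" "c \<noteq> {}" if "c \<in> P" for c
    using P that \<open>finite A\<close> by (auto simp: partition_on_def intro: finite_subset)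
  have "block_type P s u \<in> Par" for u
    unfolding block_type_def using finP finc by (intro partition_of_in_Par) auto
  moreover have "block_type P s u = []" if "u \<notin> U" for u
  proof -
    have no_block: "{c \<in> P. s c = u} = {}" using s that by auto
    show ?thesis unfolding block_type_def no_block by (simp add: partition_of_def)
  qed
  moreover have "(\<Sum>u\<in>U. sum_list (block_type P s u)) = card A"
  proof -
    have "(\<Sum>u\<in>U. sum_list (block_type P s u)) = (\<Sum>u\<in>U. \<Sum>c\<in>{c \<in> P. s c = u}. card c)"
      by (simp add: block_type_def sum_unfold_sum_mset)
    also have "\<dots> = (\<Sum>c\<in>P. card c)" by (rule sum.group[OF finP \<open>finite U\<close> s])
    also have "\<dots> = card A" using product_partition[OF P finc(1)] by simp
    finally show ?thesis .
  qed
  ultimately show ?thesis by (auto simp: Lam_def)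
qed

text \<open>Greedy construction: for each entry \<open>(u, m)\<close> cut an
  \<open>m\<close>-element block off the remaining set and label it \<open>u\<close>.\<close>

lemma ex_partition_with_labelled_sizes:
  assumes "finite A" "sum_list (map snd xs) = card A" "0 \<notin> snd ` set xs"
  shows "\<exists>P s. partition_on A P \<and> image_mset (\<lambda>c. (s c, card c)) (mset_set P) = mset xs"
  using assms
proof (induction xs arbitrary: A)
  case Nil
  hence "A = {}" by simp
  thus ?case by (intro exI[of _ "{}"]) (simp add: partition_on_empty)
next
  case (Cons x xs)
  obtain u m where x: "x = (u, m)" by fastforce
  have "m \<le> card A" using Cons.prems x by simp
  then obtain B where B: "B \<subseteq> A" "card B = m" "finite B"
    using obtain_subset_with_card_n by metis
  have "card (A - B) = card A - m" using B by (simp add: card_Diff_subset)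
  hence "sum_list (map snd xs) = card (A - B)" using Cons.prems x by simp
  then obtain P s where Ps: "partition_on (A - B) P"
    "image_mset (\<lambda>c. (s c, card c)) (mset_set P) = mset xs"
    using Cons.IH[of "A - B"] Cons.prems by auto
  \<comment> \<open>Positive sizes make \<open>B\<close> nonempty. As the blocks of \<open>P\<close>
    avoid \<open>B\<close>, it is a new block, and relabelling it leaves the labels on
    \<open>P\<close> intact.\<close>
  have "B \<noteq> {}" using B Cons.prems x by auto
  hence BP: "B \<notin> P" using Ps(1) by (auto simp: partition_on_def)
  have finP: "finite P" using finite_elements[OF _ Ps(1)] Cons.prems by simp
  have "partition_on A (insert B P)"
    using Ps(1) B \<open>B \<noteq> {}\<close>
    by (subst partition_on_insert) (auto simp: partition_on_def disjnt_iff)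
  moreover have "image_mset (\<lambda>c. ((s(B := u)) c, card c)) (mset_set P)
      = image_mset (\<lambda>c. (s c, card c)) (mset_set P)"
    using BP finP by (intro image_mset_cong) auto
  hence "image_mset (\<lambda>c. ((s(B := u)) c, card c)) (mset_set (insert B P)) = mset (x # xs)"
    using BP finP B Ps(2) x by simp
  ultimately show ?case by blast
qed

text \<open>All parts of all \<open>la u\<close>, tagged with their \<open>u\<close>, are realised
  at once as labelled block sizes; selecting a tag recovers \<open>la u\<close>.\<close>

lemma ex_block_type:
  assumes "finite A" "finite U" and la: "la \<in> Lam (card A) U"
  shows "\<exists>P s. partition_on A P \<and> s ` P \<subseteq> U \<and> block_type P s = la"
proof -
  define N where "N = (\<Sum>u\<in>U. image_mset (Pair u) (mset (la u)))"
  obtain xs where xs: "mset xs = N" using ex_mset by blast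
  have set_xs: "set xs = {(u, m). u \<in> U \<and> m \<in> set (la u)}"
    unfolding set_mset_mset[symmetric] xs N_def using \<open>finite U\<close> by (auto simp: set_mset_sum)
  have "sum_list (map snd xs) = \<Sum>\<^sub># (image_mset snd N)"
    by (metis mset_map sum_mset_sum_list xs)
  also have "\<dots> = (\<Sum>u\<in>U. sum_list (la u))"
    unfolding N_def using \<open>finite U\<close>
    by (induction U) (simp_all add: multiset.map_comp comp_def sum_mset_sum_list)
  finally have "sum_list (map snd xs) = card A" using la by (simp add: Lam_def)
  moreover have "0 \<notin> snd ` set xs" using la by (auto simp: set_xs Lam_def Par_def)
  ultimately obtain P s where P: "partition_on A P"
    and img: "image_mset (\<lambda>c. (s c, card c)) (mset_set P) = N"
    using ex_partition_with_labelled_sizes[OF \<open>finite A\<close>] xs by metis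
  have finP: "finite P" by (rule finite_elements[OF \<open>finite A\<close> P])
  have "(\<lambda>c. (s c, card c)) ` P = set xs"
    using arg_cong[OF img, of set_mset] finP by (simp flip: xs)
  hence sP: "s ` P \<subseteq> U" by (auto simp: set_xs)
  have "block_type P s u = la u" for u
  proof -
    have "image_mset card (mset_set {c \<in> P. s c = u})
        = image_mset snd (filter_mset (\<lambda>x. fst x = u) N)"
      using finP by (simp add: filter_mset_image_mset multiset.map_comp comp_def flip: img)
    also have "filter_mset (\<lambda>x. fst x = u) N = (if u \<in> U then image_mset (Pair u) (mset (la u)) else {#})"
      unfolding N_def using \<open>finite U\<close>
      by (induction U) (auto simp: filter_mset_image_mset)
    also have "image_mset snd \<dots> = mset (la u)"
      using la by (auto simp: multiset.map_comp comp_def Lam_def)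
    \<comment> \<open>Equality of multisets gives equality of lists because elements of
      \<open>Par\<close> are already sorted; for \<open>u\<close> outside \<open>U\<close> both
      sides are empty.\<close>
    finally show ?thesis
      using la partition_of_mset[of "la u"] unfolding block_type_def
      by (cases "u \<in> U") (auto simp: Lam_def partition_of_def)
  qed
  with P sP show ?thesis by blast
qed

section \<open>Permutations and wreath product elements with prescribed cycles\<close>

text \<open>Number the points of \<open>c\<close> by residues modulo \<open>m = card c\<close> and
  let \<open>\<tau>\<close> be the shift by one.\<close>

lemma ex_cyclic_permutation:
  assumes "finite c" "c \<noteq> {}"
  shows "\<exists>\<tau>. \<tau> permutes c \<and> (\<forall>x\<in>c. Orbits.orbit \<tau> x = c)"
proof -
  define m where "m = card c"
  have m: "m > 0" using assms by (simp add: m_def card_gt_0_iff)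
  obtain h where h: "bij_betw h {0..<m} c"
    using ex_bij_betw_nat_finite[OF assms(1)] m_def by blast
  define \<tau> where "\<tau> x = (if x \<in> c then h (Suc (inv_into {0..<m} h x) mod m) else x)" for x
  have hc: "h j \<in> c" if "j < m" for j using h that by (auto simp: bij_betw_def)
  have \<tau>h: "\<tau> (h j) = h (Suc j mod m)" if "j < m" for j
    using h that hc[OF that] by (simp add: \<tau>_def bij_betw_def inv_into_f_f)
  have pow: "(\<tau> ^^ j) (h 0) = h (j mod m)" for j
    by (induction j) (use m in \<open>simp_all add: \<tau>h mod_Suc_eq\<close>)
  have into: "\<tau> x \<in> c" if "x \<in> c" for x using that m hc by (simp add: \<tau>_def)
  have sub: "c \<subseteq> \<tau> ` c"
  proof
    fix x assume "x \<in> c"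
    then obtain j where j: "j < m" "x = h j" using h by (auto simp: bij_betw_def)
    \<comment> \<open>The extra \<open>m\<close> keeps the exponent positive when
      \<open>j = 0\<close>, so that a last application of \<open>\<tau>\<close> can be split
      off.\<close>
    have "x = (\<tau> ^^ (j + m)) (h 0)" using j by (simp add: pow)
    also have "\<dots> = \<tau> (h ((j + m - 1) mod m))"
      using m by (cases "j + m") (simp_all add: pow)
    finally show "x \<in> \<tau> ` c" using m hc by auto
  qed
  have "bij_betw \<tau> c c"
    using into sub finite_surj_inj[OF assms(1) sub] by (auto simp: bij_betw_def)
  hence perm: "\<tau> permutes c" by (rule bij_imp_permutes) (simp add: \<tau>_def)
  have "Orbits.orbit \<tau> (h 0) = c"
  proof
    show "Orbits.orbit \<tau> (h 0) \<subseteq> c" by (rule permutes_orbit_subset[OF perm hc[OF m]])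
    show "c \<subseteq> Orbits.orbit \<tau> (h 0)"
    proof
      fix x assume "x \<in> c"
      then obtain j where j: "j < m" "x = h j" using h by (auto simp: bij_betw_def)
      \<comment> \<open>\<open>Orbits.orbit\<close> collects positive powers only; adding
        \<open>m\<close> also reaches \<open>h 0\<close> itself.\<close>
      have "x = (\<tau> ^^ (j + m)) (h 0)" using j by (simp add: pow)
      thus "x \<in> Orbits.orbit \<tau> (h 0)" using m by (auto simp: orbit_altdef)
    qed
  qed
  hence "cyclic_on \<tau> c" using hc[OF m] unfolding cyclic_on_def by metis
  with perm show ?thesis by (meson orbit_cyclic_eq3)
qed

text \<open>For a permutation moving only points of a finite set, each point lies in its own orbit
  and orbits that meet coincide. Invariance of \<open>A\<close> keeps the orbits of its points
  inside \<open>A\<close>.\<close>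

lemma partition_on_orbits:
  assumes \<pi>: "\<pi> permutes S" and "finite S" and A: "\<And>a. a \<in> A \<Longrightarrow> \<pi> a \<in> A"
  shows "partition_on A (Orbits.orbit \<pi> ` A)"
proof (rule partition_onI)
  have p: "permutation \<pi>" using \<pi> \<open>finite S\<close> by (auto simp: permutation_permutes)
  have self: "x \<in> Orbits.orbit \<pi> x" for x by (rule permutation_self_in_orbit[OF p])
  have "Orbits.orbit \<pi> a \<subseteq> A" if "a \<in> A" for a
  proof
    fix x assume "x \<in> Orbits.orbit \<pi> a"
    thus "x \<in> A" by induction (use A that in auto)
  qed
  thus "\<Union> (Orbits.orbit \<pi> ` A) = A" using self by blast
  show "{} \<notin> Orbits.orbit \<pi> ` A" using self by force
  fix c d assume "c \<in> Orbits.orbit \<pi> ` A" "d \<in> Orbits.orbit \<pi> ` A" "c \<noteq> d"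
  then obtain a b where ab: "c = Orbits.orbit \<pi> a" "d = Orbits.orbit \<pi> b" by auto
  have "c = d" if "x \<in> c" "x \<in> d" for x
    using that unfolding ab by (metis orbit_cyclic_eq3 cyclic_on_orbit'[OF p])
  thus "disjnt c d" using \<open>c \<noteq> d\<close> by (auto simp: disjnt_iff)
qed

text \<open>Glue one cyclic permutation per block, and put the label at the minimum of the block
  with units elsewhere. The bound on the values of \<open>g\<close> later places them in the
  subgroup containing the label.\<close>

lemma ex_wreath_element:
  assumes G: "comm_group G" and P: "partition_on {1..n} P" and s: "s ` P \<subseteq> carrier G"
  shows "\<exists>g \<pi>. (g, \<pi>) \<in> carrier (wreath G n) \<and> cycles_on n \<pi> = P \<and>
    (\<forall>c\<in>P. cycle_sign G g c = s c \<and> (\<forall>x\<in>c. \<pi> x \<in> c \<and> g x \<in> {\<one>\<^bsub>G\<^esub>, s c}))"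
proof -
  interpret comm_group G by fact
  have finc: "finite c" "c \<noteq> {}" "c \<subseteq> {1..n}" if "c \<in> P" for c
    using P that by (auto simp: partition_on_def intro: finite_subset)
  have uniq: "c = d" if "c \<in> P" "d \<in> P" "x \<in> c" "x \<in> d" for c d x
    using P that by (auto simp: partition_on_def disjoint_def)
  define blk where "blk x = (THE c. c \<in> P \<and> x \<in> c)" for x
  have blk: "blk x = c" if "c \<in> P" "x \<in> c" for x c
    unfolding blk_def using that uniq by (intro the_equality) blast+
  have "\<exists>\<tau>. \<forall>c\<in>P. \<tau> c permutes c \<and> (\<forall>x\<in>c. Orbits.orbit (\<tau> c) x = c)"
    by (intro bchoice) (simp add: ex_cyclic_permutation finc)
  then obtain \<tau> where \<tau>: "\<And>c. c \<in> P \<Longrightarrow> \<tau> c permutes c"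
    and orb: "\<And>c x. c \<in> P \<Longrightarrow> x \<in> c \<Longrightarrow> Orbits.orbit (\<tau> c) x = c"
    by blast
  define \<pi> where "\<pi> x = (if x \<in> {1..n} then \<tau> (blk x) x else x)" for x
  define g where "g = (\<lambda>x\<in>{1..n}. if x = Min (blk x) then s (blk x) else \<one>\<^bsub>G\<^esub>)"
  have \<pi>c: "\<pi> x = \<tau> c x" if "c \<in> P" "x \<in> c" for c x
    using that finc(3)[OF that(1)] blk[OF that] by (auto simp: \<pi>_def)
  have gc: "g x = (if x = Min c then s c else \<one>\<^bsub>G\<^esub>)" if "c \<in> P" "x \<in> c" for c x
    using that finc(3)[OF that(1)] blk[OF that] by (auto simp: g_def)
  have ex: "\<exists>c\<in>P. x \<in> c" if "x \<in> {1..n}" for x using P that by (auto simp: partition_on_def)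
  have pres: "\<pi> x \<in> c" if "c \<in> P" "x \<in> c" for c x
    using that \<tau> \<pi>c by (metis permutes_in_image)
  have sub: "{1..n} \<subseteq> \<pi> ` {1..n}"
  proof
    fix x assume "x \<in> {1..n}"
    then obtain c where c: "c \<in> P" "x \<in> c" using ex by blast
    have "x \<in> \<tau> c ` c" using c permutes_image[OF \<tau>[OF c(1)]] by simp
    then obtain y where y: "y \<in> c" "\<tau> c y = x" by blast
    hence "\<pi> y = x" using \<pi>c c by simp
    thus "x \<in> \<pi> ` {1..n}" using y finc(3)[OF c(1)] by blast
  qed
  have "\<pi> ` {1..n} \<subseteq> {1..n}"
  proof
    fix y assume "y \<in> \<pi> ` {1..n}"
    then obtain x c where "c \<in> P" "x \<in> c" "y = \<pi> x" using ex by blast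
    thus "y \<in> {1..n}" using pres finc(3) by blast
  qed
  hence "bij_betw \<pi> {1..n} {1..n}"
    using sub finite_surj_inj[OF _ sub] by (auto simp: bij_betw_def)
  hence "\<pi> permutes {1..n}" by (rule bij_imp_permutes) (auto simp: \<pi>_def)
  moreover have "g \<in> {1..n} \<rightarrow>\<^sub>E carrier G"
  proof (intro PiE_I)
    fix x assume "x \<in> {1..n}"
    then obtain c where "c \<in> P" "x \<in> c" using ex by blast
    thus "g x \<in> carrier G" using gc s by auto
  qed (simp only: g_def restrict_def if_False)
  ultimately have "(g, \<pi>) \<in> carrier (wreath G n)" by (simp add: wreath_def)
  \<comment> \<open>The point \<open>x\<close> lies in its orbit \<open>c\<close> under
    \<open>\<tau> c\<close>, and \<open>\<pi>\<close> agrees with \<open>\<tau> c\<close> on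
    \<open>c\<close>, so both have the same orbit there.\<close>
  moreover have orb\<pi>: "Orbits.orbit \<pi> x = c" if c: "c \<in> P" "x \<in> c" for c x
    using orbit_cong[of x "\<tau> c" \<pi>] orb[OF c] \<pi>c[OF c(1)] c(2) by simp
  have "cycles_on n \<pi> = P"
  proof
    show "cycles_on n \<pi> \<subseteq> P" unfolding cycles_on_def using ex orb\<pi> by (metis image_subsetI)
    show "P \<subseteq> cycles_on n \<pi>"
    proof
      fix c assume c: "c \<in> P"
      then obtain x where "x \<in> c" using finc by blast
      thus "c \<in> cycles_on n \<pi>" using orb\<pi>[OF c] finc(3)[OF c] by (auto simp: cycles_on_def)
    qed
  qed
  moreover have "cycle_sign G g c = s c" if c: "c \<in> P" for c
  proof -
    have sc: "s c \<in> carrier G" using s c by auto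
    have "cycle_sign G g c = (\<Otimes>\<^bsub>G\<^esub>i\<in>c. if Min c = i then s c else \<one>\<^bsub>G\<^esub>)"
      unfolding cycle_sign_def using gc[OF c] sc by (intro finprod_cong') auto
    also have "\<dots> = s c"
      using finprod_singleton[of "Min c" c "\<lambda>_. s c"] finc[OF c] sc by simp
    finally show ?thesis .
  qed
  moreover have "g x \<in> {\<one>\<^bsub>G\<^esub>, s c}" if "c \<in> P" "x \<in> c" for c x
    using gc[OF that] by simp
  moreover note pres
  ultimately show ?thesis by (intro exI[of _ g] exI[of _ \<pi>] conjI ballI)
qed

section \<open>The two inclusions between \<open>C_set\<close> and the set of unions\<close>

theorem theorem4p9:
  fixes G :: "('a, 'b) monoid_scheme"
    and n l :: nat
    and \<sigma> :: "'a set \<Rightarrow> nat list"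
    and t :: "('a set \<times> nat \<times> nat \<Rightarrow> 'a set \<times> nat) set"
    and U :: "nat \<Rightarrow> 'a set"
    and A :: "nat \<Rightarrow> nat set"
    and k :: "nat \<Rightarrow> nat"
  assumes "comm_group G"
    and "finite (carrier G)"
    and "n > 0"
    and "\<sigma> \<in> Sig G n"
    and "t \<in> tabloids G n \<sigma>"
    and "\<And>i. i \<in> {1..l} \<Longrightarrow> subgroup (U i) G"
    and "disjoint_family_on A {1..l}"
    and "(\<Union>i\<in>{1..l}. A i) = {1..n}"
    and "\<And>i. i \<in> {1..l} \<Longrightarrow> card (A i) = k i"
    and "internal_direct_product (wreath G n) (tabloid_stab G n \<sigma> t) l
           (\<lambda>i. wreath_sub G n (U i) (A i))"
  shows "C_set G n \<sigma> t = {map_union l la | la. \<forall>i\<in>{1..l}. la i \<in> Lam (k i) (U i)}"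
proof -
  interpret comm_group G by fact
  note sub = assms(6) and dis = assms(7) and cov = assms(8) and cardA = assms(9)
  have H: "tabloid_stab G n \<sigma> t
      = {(g, \<pi>) \<in> carrier (wreath G n). \<forall>i\<in>{1..l}. \<forall>a\<in>A i. \<pi> a \<in> A i \<and> g a \<in> U i}"
    by (rule internal_direct_product_wreath_sub[OF assms(1) dis cov assms(10)])
  have finA: "finite (A i)" if "i \<in> {1..l}" for i
    using cov that finite_subset[of "A i" "{1..n}"] by blast
  have UG: "U i \<subseteq> carrier G" and finU: "finite (U i)" if "i \<in> {1..l}" for i
    using subgroup.subset[OF sub[OF that]] assms(2) by (auto intro: finite_subset)
  show ?thesis
  proof (intro subset_antisym subsetI)
    fix la assume "la \<in> C_set G n \<sigma> t"
    then obtain g \<pi> where w: "(g, \<pi>) \<in> tabloid_stab G n \<sigma> t" and la: "cycle_type G n (g, \<pi>) = la"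
      by (auto simp: C_set_def conj_class_def)
    have \<pi>: "\<pi> permutes {1..n}"
      and pres: "\<And>i a. i \<in> {1..l} \<Longrightarrow> a \<in> A i \<Longrightarrow> \<pi> a \<in> A i \<and> g a \<in> U i"
      using w unfolding H by (auto simp: wreath_def)
    define P where "P i = Orbits.orbit \<pi> ` A i" for i
    have P: "partition_on (A i) (P i)" if "i \<in> {1..l}" for i
      unfolding P_def using partition_on_orbits[OF \<pi>] pres[OF that] by auto
    have cyc: "cycles_on n \<pi> = (\<Union>i\<in>{1..l}. P i)"
      unfolding cycles_on_def P_def cov[symmetric] by (rule image_UN)
    have "la = map_union l (\<lambda>i. block_type (P i) (cycle_sign G g))"
      unfolding la[symmetric] cycle_type_eq_block_type cyc by (rule block_type_Union[OF P finA dis])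
    moreover have "block_type (P i) (cycle_sign G g) \<in> Lam (k i) (U i)" if i: "i \<in> {1..l}" for i
    proof -
      \<comment> \<open>Only \<open>c \<subseteq> A i\<close> matters: a finite product of values of
        \<open>g\<close> on \<open>A i\<close> stays in the subgroup \<open>U i\<close>, by
        induction on \<open>c\<close>.\<close>
      have "cycle_sign G g c \<in> U i" if "c \<in> P i" for c
      proof -
        have cA: "c \<subseteq> A i" using P[OF i] that by (auto simp: partition_on_def)
        hence "finite c" using finA[OF i] finite_subset by blast
        thus ?thesis using cA unfolding cycle_sign_def
        proof (induction c)
          case empty
          show ?case using subgroup.one_closed[OF sub[OF i]] by simp
        next
          case (insert x c)
          have "g y \<in> carrier G" if "y \<in> insert x c" for y
            using pres[OF i] UG[OF i] insert.prems that by blast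
          hence "finprod G g (insert x c) = g x \<otimes>\<^bsub>G\<^esub> finprod G g c"
            using insert.hyps by (intro finprod_insert) auto
          thus ?case using insert pres[OF i] subgroup.m_closed[OF sub[OF i]] by simp
        qed
      qed
      thus ?thesis using block_type_in_Lam[OF P[OF i] finA[OF i] finU[OF i]] cardA[OF i] by force
    qed
    ultimately show "la \<in> {map_union l la | la. \<forall>i\<in>{1..l}. la i \<in> Lam (k i) (U i)}" by blast
  next
    fix x assume "x \<in> {map_union l la | la. \<forall>i\<in>{1..l}. la i \<in> Lam (k i) (U i)}"
    then obtain la where x: "x = map_union l la"
      and la: "\<And>i. i \<in> {1..l} \<Longrightarrow> la i \<in> Lam (k i) (U i)" by blast
    have "\<exists>P s. partition_on (A i) P \<and> s ` P \<subseteq> U i \<and> block_type P s = la i" if "i \<in> {1..l}" for i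
      using ex_block_type[OF finA[OF that] finU[OF that]] la[OF that] cardA[OF that] by simp
    hence "\<exists>P. \<forall>i\<in>{1..l}. \<exists>s. partition_on (A i) (P i) \<and> s ` P i \<subseteq> U i \<and> block_type (P i) s = la i"
      by (intro bchoice) blast
    then obtain P where "\<forall>i\<in>{1..l}. \<exists>s. partition_on (A i) (P i) \<and> s ` P i \<subseteq> U i \<and> block_type (P i) s = la i"
      by (elim exE)
    from bchoice[OF this] obtain s where Ps: "\<forall>i\<in>{1..l}. partition_on (A i) (P i) \<and>
        s i ` P i \<subseteq> U i \<and> block_type (P i) (s i) = la i"
      by (elim exE)
    have P: "partition_on (A i) (P i)" and s: "\<And>c. c \<in> P i \<Longrightarrow> s i c \<in> U i"
      and bt: "block_type (P i) (s i) = la i" if "i \<in> {1..l}" for i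
      using bspec[OF Ps that] by (simp_all add: image_subset_iff)
    \<comment> \<open>The label functions \<open>s i\<close> may disagree away from their own
      blocks. Every block lies in exactly one \<open>P i\<close>, so they merge into one function
      \<open>r\<close> on all blocks.\<close>
    define r where "r c = s (THE i. i \<in> {1..l} \<and> c \<in> P i) c" for c
    have r: "r c = s i c" if "i \<in> {1..l}" "c \<in> P i" for i c
    proof -
      have "j = i" if j: "j \<in> {1..l}" "c \<in> P j" for j
      proof (rule ccontr)
        assume "j \<noteq> i"
        hence "A i \<inter> A j = {}" using dis j \<open>i \<in> {1..l}\<close> by (auto simp: disjoint_family_on_def)
        moreover have "c \<subseteq> A i" "c \<subseteq> A j" "c \<noteq> {}"
          using P j \<open>i \<in> {1..l}\<close> \<open>c \<in> P i\<close> by (auto simp: partition_on_def)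
        ultimately show False by blast
      qed
      hence "(THE i. i \<in> {1..l} \<and> c \<in> P i) = i" using that by (intro the_equality) blast+
      thus ?thesis by (simp add: r_def)
    qed
    let ?P = "\<Union>i\<in>{1..l}. P i"
    have "partition_on {1..n} ?P"
    proof (rule partition_onI)
      show "\<Union> ?P = {1..n}" using P unfolding cov[symmetric] partition_on_def by blast
      show "{} \<notin> ?P" using P unfolding partition_on_def by blast
      fix c d assume "c \<in> ?P" "d \<in> ?P" "c \<noteq> d"
      then obtain i j where ij: "i \<in> {1..l}" "c \<in> P i" "j \<in> {1..l}" "d \<in> P j" by blast
      show "disjnt c d"
      proof (cases "i = j")
        case True
        thus ?thesis using P[OF ij(1)] ij \<open>c \<noteq> d\<close> by (auto simp: partition_on_def pairwise_def)
      next
        case False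
        hence "A i \<inter> A j = {}" using dis ij by (auto simp: disjoint_family_on_def)
        thus ?thesis using P[OF ij(1)] P[OF ij(3)] ij unfolding partition_on_def disjnt_def by blast
      qed
    qed
    moreover have "r ` ?P \<subseteq> carrier G" using r s UG by fastforce
    ultimately obtain g \<pi> where w: "(g, \<pi>) \<in> carrier (wreath G n)" and cyc: "cycles_on n \<pi> = ?P"
      and sgn: "\<And>c. c \<in> ?P \<Longrightarrow> cycle_sign G g c = r c"
      and pres: "\<And>c x. c \<in> ?P \<Longrightarrow> x \<in> c \<Longrightarrow> \<pi> x \<in> c \<and> g x \<in> {\<one>\<^bsub>G\<^esub>, r c}"
      using ex_wreath_element[OF assms(1)] by metis
    \<comment> \<open>The block of \<open>a\<close> lies inside \<open>A i\<close>, and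
      \<open>g a\<close> is the unit or the label of this block, both elements of
      \<open>U i\<close>.\<close>
    have "\<pi> a \<in> A i \<and> g a \<in> U i" if i: "i \<in> {1..l}" and a: "a \<in> A i" for i a
    proof -
      have "\<Union> (P i) = A i" using P[OF i] by (simp add: partition_on_def)
      then obtain c where c: "c \<in> P i" "a \<in> c" "c \<subseteq> A i" using a by blast
      have "c \<in> ?P" using i c(1) by blast
      hence "\<pi> a \<in> c" "g a \<in> {\<one>\<^bsub>G\<^esub>, s i c}" using pres[of c a] c(2) r[OF i c(1)] by auto
      thus ?thesis using c s[OF i] subgroup.one_closed[OF sub[OF i]] by auto
    qed
    hence "(g, \<pi>) \<in> tabloid_stab G n \<sigma> t" unfolding H using w by blast
    moreover have "cycle_type G n (g, \<pi>) = x"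
    proof -
      have "{c \<in> P i. cycle_sign G g c = h} = {c \<in> P i. s i c = h}" if i: "i \<in> {1..l}" for i h
      proof (rule Collect_cong, rule conj_cong[OF refl])
        fix c assume c: "c \<in> P i"
        have "cycle_sign G g c = s i c" using sgn[OF UN_I[where B = P, OF i c]] r[OF i c] by simp
        thus "cycle_sign G g c = h \<longleftrightarrow> s i c = h" by simp
      qed
      hence "block_type (P i) (cycle_sign G g) = la i" if "i \<in> {1..l}" for i
        using that unfolding bt[OF that, symmetric] block_type_def by simp
      \<comment> \<open>\<open>map_union l\<close> evaluates its family only at indices in
        \<open>{1..l}\<close>, where the block types are known.\<close>
      hence "map_union l (\<lambda>i. block_type (P i) (cycle_sign G g)) = x"
        by (simp add: x map_union_eq fun_eq_iff)
      moreover have "cycle_type G n (g, \<pi>) = map_union l (\<lambda>i. block_type (P i) (cycle_sign G g))"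
        unfolding cycle_type_eq_block_type cyc by (rule block_type_Union[OF P finA dis])
      ultimately show ?thesis by simp
    qed
    \<comment> \<open>\<open>C_set\<close> requires its members to have total size \<open>n\<close>;
      this holds because the disjoint sets \<open>A i\<close> cover \<open>{1..n}\<close>.\<close>
    moreover have "(\<Sum>i\<in>{1..l}. k i) = n"
      using card_UN_disjoint[of "{1..l}" A] finA dis cov cardA
      by (simp add: disjoint_family_on_def)
    hence "x \<in> Lam n (carrier G)"
      using map_union_in_Lam[where C = "carrier G" and U = U and la = la and k = k and l = l]
        assms(2) UG la x by blast
    ultimately show "x \<in> C_set G n \<sigma> t"
      using w by (auto simp: C_set_def conj_class_def)
  qed
qed

end
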